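(* Let $\mathcal{G}\mathsf{L}$ be any of $\mathcal{G}\mathsf{N4}$, $\mathcal{G}\mathsf{CN4K}$, $\mathcal{G}\mathsf{CN4K}^\pm$, $\mathcal{G}\mathsf{CN4K}^\curlyvee$, $\mathcal{G}\mathsf{CN4K}^{\Join}$, $\mathcal{G}\mathsf{CN4K}^1$. The cut rule (from $\Gamma\Rightarrow\phi$ and $\phi,\Delta\Rightarrow\chi$ infer $\Gamma,\Delta\Rightarrow\chi$) is admissible in $\mathcal{G}\mathsf{L}$: if both premises are provable in $\mathcal{G}\mathsf{L}$, so is the conclusion.
   Context: Fix a countable set $\mathsf{Prop}$ of propositional variables. The language $\mathcal{L}$ is given by the grammar $\phi::=p\mid{\sim}\phi\mid(\phi\wedge\phi)\mid(\phi\vee\phi)\mid(\phi\to\phi)\mid\Box\phi\mid\Diamond\phi$ with $p\in\mathsf{Prop}$ (for $\mathcal{G}\mathsf{N4}$ only modality-free formulas are used). A sequent is $\Gamma\Rightarrow\phi$ with $\Gamma$ a finite multiset of formulas and $\phi$ a single formula. $\Gamma^\Box=\{\phi\mid\Box\phi\in\Gamma\}$, $\Gamma^\Diamond_\sim=\{{\sim}\phi\mid{\sim}\Diamond\phi\in\Gamma\}$ (multisets). Rules are written premise(s) / conclusion. Rules of $\mathcal{G}\mathsf{N4}$: axioms $p,\Gamma\Rightarrow p$ and ${\sim}p,\Gamma\Rightarrow{\sim}p$ ($p\in\mathsf{Prop}$); ${\sim}{\sim}_l$: $\phi,\Gamma\Rightarrow\psi$ / ${\sim}{\sim}\phi,\Gamma\Rightarrow\psi$;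 ${\sim}{\sim}_r$: $\Gamma\Rightarrow\phi$ / $\Gamma\Rightarrow{\sim}{\sim}\phi$; $\wedge_l$: $\phi,\chi,\Gamma\Rightarrow\psi$ / $\phi\wedge\chi,\Gamma\Rightarrow\psi$; $\wedge_r$: $\Gamma\Rightarrow\phi$ and $\Gamma\Rightarrow\chi$ / $\Gamma\Rightarrow\phi\wedge\chi$; $\vee_l$: $\phi,\Gamma\Rightarrow\psi$ and $\chi,\Gamma\Rightarrow\psi$ / $\phi\vee\chi,\Gamma\Rightarrow\psi$; $\vee_{r_1}$: $\Gamma\Rightarrow\phi$ / $\Gamma\Rightarrow\phi\vee\chi$; $\vee_{r_2}$: $\Gamma\Rightarrow\chi$ / $\Gamma\Rightarrow\phi\vee\chi$; ${\sim}\vee_l$: ${\sim}\phi,{\sim}\chi,\Gamma\Rightarrow\psi$ / ${\sim}(\phi\vee\chi),\Gamma\Rightarrow\psi$; ${\sim}\vee_r$: $\Gamma\Rightarrow{\sim}\phi$ and $\Gamma\Rightarrow{\sim}\chi$ / $\Gamma\Rightarrow{\sim}(\phi\vee\chi)$; ${\sim}\wedge_l$: ${\sim}\phi,\Gamma\Rightarrow\psi$ and ${\sim}\chi,\Gamma\Rightarrow\psi$ / ${\sim}(\phi\wedge\chi),\Gamma\Rightarrow\psi$; ${\sim}\wedge_{r_1}$: $\Gamma\Rightarrow{\sim}\phi$ / $\Gamma\Rightarrow{\sim}(\phi\wedge\chi)$; ${\sim}\wedge_{r_2}$: $\Gamma\Rightarrow{\sim}\chi$ / $\Gamma\Rightarrow{\sim}(\phi\wedge\chi)$;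 $\to_l$: $\phi\to\chi,\Gamma\Rightarrow\phi$ and $\chi,\Gamma\Rightarrow\psi$ / $\phi\to\chi,\Gamma\Rightarrow\psi$; $\to_r$: $\Gamma,\phi\Rightarrow\chi$ / $\Gamma\Rightarrow\phi\to\chi$; ${\sim}\!\to_l$: $\phi,{\sim}\chi,\Gamma\Rightarrow\psi$ / ${\sim}(\phi\to\chi),\Gamma\Rightarrow\psi$; ${\sim}\!\to_r$: $\Gamma\Rightarrow\phi$ and $\Gamma\Rightarrow{\sim}\chi$ / $\Gamma\Rightarrow{\sim}(\phi\to\chi)$. Modal rules: $\Box$: $\Gamma^\Box\Rightarrow\chi$ / $\Gamma\Rightarrow\Box\chi$; $\Diamond$: $\phi\Rightarrow\chi$ / $\Gamma,\Diamond\phi\Rightarrow\Diamond\chi$; $\Box_\sim$: ${\sim}\phi\Rightarrow{\sim}\chi$ / $\Gamma,{\sim}\Box\phi\Rightarrow{\sim}\Box\chi$; $\Diamond_\sim$: $\Gamma^\Diamond_\sim\Rightarrow{\sim}\chi$ / $\Gamma\Rightarrow{\sim}\Diamond\chi$; $\Diamond^\pm$: $\Gamma^\Box,\phi\Rightarrow\chi$ / $\Gamma,\Diamond\phi\Rightarrow\Diamond\chi$; $\Box^\pm_\sim$: $\Gamma^\Diamond_\sim,{\sim}\phi\Rightarrow{\sim}\chi$ / $\Gamma,{\sim}\Box\phi\Rightarrow{\sim}\Box\chi$; $\Diamond^\curlyvee$: $\Gamma^\Diamond_\sim,\phi\Rightarrow\chi$ / $\Gamma,\Diamond\phi\Rightarrow\Diamond\chi$;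 $\Box^\curlyvee_\sim$: $\Gamma^\Box,{\sim}\phi\Rightarrow{\sim}\chi$ / $\Gamma,{\sim}\Box\phi\Rightarrow{\sim}\Box\chi$; $\Box^{\Join}$: $\Gamma^\Box,\Gamma^\Diamond_\sim\Rightarrow\chi$ / $\Gamma\Rightarrow\Box\chi$; $\Diamond^{\Join}$: ${\sim}\phi\Rightarrow\chi$ / $\Gamma,{\sim}\Box\phi\Rightarrow\Diamond\chi$; $\Box^{\Join}_\sim$: $\phi\Rightarrow{\sim}\chi$ / $\Gamma,\Diamond\phi\Rightarrow{\sim}\Box\chi$; $\Diamond^{\Join}_\sim$: $\Gamma^\Box,\Gamma^\Diamond_\sim\Rightarrow{\sim}\chi$ / $\Gamma\Rightarrow{\sim}\Diamond\chi$; $\Diamond^1$: $\Gamma^\Box,\Gamma^\Diamond_\sim,\phi\Rightarrow\chi$ / $\Gamma,\Diamond\phi\Rightarrow\Diamond\chi$; $\Box^1_\sim$: $\Gamma^\Box,\Gamma^\Diamond_\sim,{\sim}\phi\Rightarrow{\sim}\chi$ / $\Gamma,{\sim}\Box\phi\Rightarrow{\sim}\Box\chi$; $\Diamond^{1,\Join}$: $\Gamma^\Box,\Gamma^\Diamond_\sim,{\sim}\phi\Rightarrow\chi$ / $\Gamma,{\sim}\Box\phi\Rightarrow\Diamond\chi$; $\Box^{1,\Join}_\sim$: $\Gamma^\Box,\Gamma^\Diamond_\sim,\phi\Rightarrow{\sim}\chi$ / $\Gamma,\Diamond\phi\Rightarrow{\sim}\Box\chi$. Calculi: $\mathcal{G}\mathsf{CN4K}=\mathcal{G}\mathsf{N4}+\{\Box,\Diamond,\Box_\sim,\Diamond_\sim\}$;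 $\mathcal{G}\mathsf{CN4K}^\curlyvee=\mathcal{G}\mathsf{N4}+\{\Box,\Diamond^\curlyvee,\Box^\curlyvee_\sim,\Diamond_\sim\}$; $\mathcal{G}\mathsf{CN4K}^\pm=\mathcal{G}\mathsf{N4}+\{\Box,\Diamond^\pm,\Box^\pm_\sim,\Diamond_\sim\}$; $\mathcal{G}\mathsf{CN4K}^{\Join}=\mathcal{G}\mathsf{N4}+\{\Box^{\Join},\Diamond,\Diamond^{\Join},\Box_\sim,\Box^{\Join}_\sim,\Diamond^{\Join}_\sim\}$; $\mathcal{G}\mathsf{CN4K}^1=\mathcal{G}\mathsf{N4}+\{\Box^{\Join},\Diamond^1,\Diamond^{1,\Join},\Box^1_\sim,\Box^{1,\Join}_\sim,\Diamond^{\Join}_\sim\}$. A proof is a finite tree of sequents, each node obtained from its children by a rule, whose leaves are axioms. *)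

theory Defs
  imports Main "HOL-Library.Multiset" "HOL-Library.Countable"
begin

datatype 'p fm =
    Atom 'p
  | Neg "'p fm"
  | Conj "'p fm" "'p fm"
  | Disj "'p fm" "'p fm"
  | Imp "'p fm" "'p fm"
  | Box "'p fm"
  | Dia "'p fm"

fun modal_free :: "'p fm \<Rightarrow> bool" where
  "modal_free (Atom p) = True"
| "modal_free (Neg a) = modal_free a"
| "modal_free (Conj a b) = (modal_free a \<and> modal_free b)"
| "modal_free (Disj a b) = (modal_free a \<and> modal_free b)"
| "modal_free (Imp a b) = (modal_free a \<and> modal_free b)"
| "modal_free (Box a) = False"
| "modal_free (Dia a) = False"

fun boxpart :: "'p fm \<Rightarrow> 'p fm multiset" where
  "boxpart (Box a) = {#a#}"
| "boxpart _ = {#}"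

definition boxes :: "'p fm multiset \<Rightarrow> 'p fm multiset" where
  "boxes \<Gamma> = sum_mset (image_mset boxpart \<Gamma>)"

fun negdiapart :: "'p fm \<Rightarrow> 'p fm multiset" where
  "negdiapart (Neg (Dia a)) = {#Neg a#}"
| "negdiapart _ = {#}"

definition negdias :: "'p fm multiset \<Rightarrow> 'p fm multiset" where
  "negdias \<Gamma> = sum_mset (image_mset negdiapart \<Gamma>)"

datatype calculus = GN4 | GCN4K | GCN4K_pm | GCN4K_vee | GCN4K_join | GCN4K_1

datatype modal_rule =
    R_Box | R_Dia | R_Box_neg | R_Dia_neg
  | R_Dia_pm | R_Box_neg_pm
  | R_Dia_vee | R_Box_neg_vee
  | R_Box_join | R_Dia_join | R_Box_neg_join | R_Dia_neg_join
  | R_Dia_1 | R_Box_neg_1 | R_Dia_1join | R_Box_neg_1join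

fun modal_rules :: "calculus \<Rightarrow> modal_rule set" where
  "modal_rules GN4 = {}"
| "modal_rules GCN4K = {R_Box, R_Dia, R_Box_neg, R_Dia_neg}"
| "modal_rules GCN4K_vee = {R_Box, R_Dia_vee, R_Box_neg_vee, R_Dia_neg}"
| "modal_rules GCN4K_pm = {R_Box, R_Dia_pm, R_Box_neg_pm, R_Dia_neg}"
| "modal_rules GCN4K_join = {R_Box_join, R_Dia, R_Dia_join, R_Box_neg, R_Box_neg_join, R_Dia_neg_join}"
| "modal_rules GCN4K_1 = {R_Box_join, R_Dia_1, R_Dia_1join, R_Box_neg_1, R_Box_neg_1join, R_Dia_neg_join}"

inductive provable :: "calculus \<Rightarrow> 'p fm multiset \<Rightarrow> 'p fm \<Rightarrow> bool" for L where
  ax: "provable L (add_mset (Atom p) \<Gamma>) (Atom p)"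
| ax_neg: "provable L (add_mset (Neg (Atom p)) \<Gamma>) (Neg (Atom p))"
| negneg_l: "provable L (add_mset a \<Gamma>) c \<Longrightarrow> provable L (add_mset (Neg (Neg a)) \<Gamma>) c"
| negneg_r: "provable L \<Gamma> a \<Longrightarrow> provable L \<Gamma> (Neg (Neg a))"
| conj_l: "provable L (add_mset a (add_mset b \<Gamma>)) c \<Longrightarrow> provable L (add_mset (Conj a b) \<Gamma>) c"
| conj_r: "provable L \<Gamma> a \<Longrightarrow> provable L \<Gamma> b \<Longrightarrow> provable L \<Gamma> (Conj a b)"
| disj_l: "provable L (add_mset a \<Gamma>) c \<Longrightarrow> provable L (add_mset b \<Gamma>) c \<Longrightarrow> provable L (add_mset (Disj a b) \<Gamma>) c"
| disj_r1: "provable L \<Gamma> a \<Longrightarrow> provable L \<Gamma> (Disj a b)"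
| disj_r2: "provable L \<Gamma> b \<Longrightarrow> provable L \<Gamma> (Disj a b)"
| negdisj_l: "provable L (add_mset (Neg a) (add_mset (Neg b) \<Gamma>)) c \<Longrightarrow> provable L (add_mset (Neg (Disj a b)) \<Gamma>) c"
| negdisj_r: "provable L \<Gamma> (Neg a) \<Longrightarrow> provable L \<Gamma> (Neg b) \<Longrightarrow> provable L \<Gamma> (Neg (Disj a b))"
| negconj_l: "provable L (add_mset (Neg a) \<Gamma>) c \<Longrightarrow> provable L (add_mset (Neg b) \<Gamma>) c \<Longrightarrow> provable L (add_mset (Neg (Conj a b)) \<Gamma>) c"
| negconj_r1: "provable L \<Gamma> (Neg a) \<Longrightarrow> provable L \<Gamma> (Neg (Conj a b))"
| negconj_r2: "provable L \<Gamma> (Neg b) \<Longrightarrow> provable L \<Gamma> (Neg (Conj a b))"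
| imp_l: "provable L (add_mset (Imp a b) \<Gamma>) a \<Longrightarrow> provable L (add_mset b \<Gamma>) c \<Longrightarrow> provable L (add_mset (Imp a b) \<Gamma>) c"
| imp_r: "provable L (add_mset a \<Gamma>) b \<Longrightarrow> provable L \<Gamma> (Imp a b)"
| negimp_l: "provable L (add_mset a (add_mset (Neg b) \<Gamma>)) c \<Longrightarrow> provable L (add_mset (Neg (Imp a b)) \<Gamma>) c"
| negimp_r: "provable L \<Gamma> a \<Longrightarrow> provable L \<Gamma> (Neg b) \<Longrightarrow> provable L \<Gamma> (Neg (Imp a b))"
| box: "R_Box \<in> modal_rules L \<Longrightarrow> provable L (boxes \<Gamma>) c \<Longrightarrow> provable L \<Gamma> (Box c)"
| dia: "R_Dia \<in> modal_rules L \<Longrightarrow> provable L {#a#} c \<Longrightarrow> provable L (add_mset (Dia a) \<Gamma>) (Dia c)"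
| box_neg: "R_Box_neg \<in> modal_rules L \<Longrightarrow> provable L {#Neg a#} (Neg c) \<Longrightarrow> provable L (add_mset (Neg (Box a)) \<Gamma>) (Neg (Box c))"
| dia_neg: "R_Dia_neg \<in> modal_rules L \<Longrightarrow> provable L (negdias \<Gamma>) (Neg c) \<Longrightarrow> provable L \<Gamma> (Neg (Dia c))"
| dia_pm: "R_Dia_pm \<in> modal_rules L \<Longrightarrow> provable L (add_mset a (boxes \<Gamma>)) c \<Longrightarrow> provable L (add_mset (Dia a) \<Gamma>) (Dia c)"
| box_neg_pm: "R_Box_neg_pm \<in> modal_rules L \<Longrightarrow> provable L (add_mset (Neg a) (negdias \<Gamma>)) (Neg c) \<Longrightarrow> provable L (add_mset (Neg (Box a)) \<Gamma>) (Neg (Box c))"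
| dia_vee: "R_Dia_vee \<in> modal_rules L \<Longrightarrow> provable L (add_mset a (negdias \<Gamma>)) c \<Longrightarrow> provable L (add_mset (Dia a) \<Gamma>) (Dia c)"
| box_neg_vee: "R_Box_neg_vee \<in> modal_rules L \<Longrightarrow> provable L (add_mset (Neg a) (boxes \<Gamma>)) (Neg c) \<Longrightarrow> provable L (add_mset (Neg (Box a)) \<Gamma>) (Neg (Box c))"
| box_join: "R_Box_join \<in> modal_rules L \<Longrightarrow> provable L (boxes \<Gamma> + negdias \<Gamma>) c \<Longrightarrow> provable L \<Gamma> (Box c)"
| dia_join: "R_Dia_join \<in> modal_rules L \<Longrightarrow> provable L {#Neg a#} c \<Longrightarrow> provable L (add_mset (Neg (Box a)) \<Gamma>) (Dia c)"
| box_neg_join: "R_Box_neg_join \<in> modal_rules L \<Longrightarrow> provable L {#a#} (Neg c) \<Longrightarrow> provable L (add_mset (Dia a) \<Gamma>) (Neg (Box c))"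
| dia_neg_join: "R_Dia_neg_join \<in> modal_rules L \<Longrightarrow> provable L (boxes \<Gamma> + negdias \<Gamma>) (Neg c) \<Longrightarrow> provable L \<Gamma> (Neg (Dia c))"
| dia_1: "R_Dia_1 \<in> modal_rules L \<Longrightarrow> provable L (add_mset a (boxes \<Gamma> + negdias \<Gamma>)) c \<Longrightarrow> provable L (add_mset (Dia a) \<Gamma>) (Dia c)"
| box_neg_1: "R_Box_neg_1 \<in> modal_rules L \<Longrightarrow> provable L (add_mset (Neg a) (boxes \<Gamma> + negdias \<Gamma>)) (Neg c) \<Longrightarrow> provable L (add_mset (Neg (Box a)) \<Gamma>) (Neg (Box c))"
| dia_1join: "R_Dia_1join \<in> modal_rules L \<Longrightarrow> provable L (add_mset (Neg a) (boxes \<Gamma> + negdias \<Gamma>)) c \<Longrightarrow> provable L (add_mset (Neg (Box a)) \<Gamma>) (Dia c)"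
| box_neg_1join: "R_Box_neg_1join \<in> modal_rules L \<Longrightarrow> provable L (add_mset a (boxes \<Gamma> + negdias \<Gamma>)) (Neg c) \<Longrightarrow> provable L (add_mset (Dia a) \<Gamma>) (Neg (Box c))"

fun in_language :: "calculus \<Rightarrow> 'p fm \<Rightarrow> bool" where
  "in_language GN4 a = modal_free a"
| "in_language _ a = True"

end

theory Submission
  imports Defs
begin

text \<open>
  All six calculi are instances of one calculus \<open>gen\<close> with few rules. The propositional
  connectives other than implication are governed by a disjunctive normal form \<open>dnf\<close>: on the
  left every disjunct has to be treated, on the right one disjunct is chosen and all its members are
  proved. The modal rules are governed by two parameters: \<open>kept\<close> says which necessity
  formulas of the antecedent survive, and \<open>links\<close> says which possibility formula of the
  antecedent may support which possibility formula in the succedent. Cut elimination only needs that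
  \<open>kept\<close> and \<open>links\<close> are transitive in a suitable sense.

  No heights of derivations are needed. Left rules for \<open>dnf\<close> formulas are invertible, so
  contraction follows by induction on the formula and then on the derivation. Cut is proved by
  induction on the cut formula and then on the derivation of the left premise; the right premise is
  either inverted or, for implications and modal formulas, treated by a further induction.
\<close>

section \<open>The generic calculus\<close>

text \<open>\<open>Neg (Dia a)\<close> counts as a necessity of \<open>Neg a\<close>, and
  \<open>Neg (Box a)\<close> as a possibility of \<open>Neg a\<close>; \<open>core\<close> is the
  formula so modalised.\<close>

datatype kind = KBox | KNegDia | KDia | KNegBox

fun mf :: "kind \<Rightarrow> 'p fm \<Rightarrow> 'p fm" where
  "mf KBox a = Box a"
| "mf KNegDia a = Neg (Dia a)"
| "mf KDia a = Dia a"
| "mf KNegBox a = Neg (Box a)"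

fun core :: "kind \<Rightarrow> 'p fm \<Rightarrow> 'p fm" where
  "core KBox a = a"
| "core KNegDia a = Neg a"
| "core KDia a = a"
| "core KNegBox a = Neg a"

definition necessities :: "calculus \<Rightarrow> kind set" where
  "necessities L = (if L = GN4 then {} else {KBox, KNegDia})"

fun links :: "calculus \<Rightarrow> (kind \<times> kind) set" where
  "links GN4 = {}"
| "links GCN4K_join = {KDia, KNegBox} \<times> {KDia, KNegBox}"
| "links GCN4K_1 = {KDia, KNegBox} \<times> {KDia, KNegBox}"
| "links _ = {(KDia, KDia), (KNegBox, KNegBox)}"

text \<open>The kind \<open>k\<close> is that of the succedent. Equations apply in order, so those
  with a variable \<open>L\<close> concern only \<open>GCN4K\<close>, \<open>GCN4K_pm\<close> and
  \<open>GCN4K_vee\<close>.\<close>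

fun kept :: "calculus \<Rightarrow> kind \<Rightarrow> kind set" where
  "kept GN4 k = {}"
| "kept GCN4K_1 k = {KBox, KNegDia}"
| "kept GCN4K_join k = (if k \<in> {KBox, KNegDia} then {KBox, KNegDia} else {})"
| "kept L KBox = {KBox}"
| "kept L KNegDia = {KNegDia}"
| "kept GCN4K_pm KDia = {KBox}"
| "kept GCN4K_pm KNegBox = {KNegDia}"
| "kept GCN4K_vee KDia = {KNegDia}"
| "kept GCN4K_vee KNegBox = {KBox}"
| "kept GCN4K k = {}"

definition part :: "kind set \<Rightarrow> 'p fm \<Rightarrow> 'p fm multiset" where
  "part K a = (if KBox \<in> K then boxpart a else {#}) + (if KNegDia \<in> K then negdiapart a else {#})"

definition proj :: "kind set \<Rightarrow> 'p fm multiset \<Rightarrow> 'p fm multiset" where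
  "proj K \<Gamma> = (if KBox \<in> K then boxes \<Gamma> else {#}) + (if KNegDia \<in> K then negdias \<Gamma> else {#})"

text \<open>The set is a disjunction, each multiset in it a conjunction. The default
  \<open>{}\<close> is not falsity: it marks literals, implications and modal formulas, which have
  rules of their own.\<close>

fun dnf :: "'p fm \<Rightarrow> 'p fm multiset set" where
  "dnf (Neg (Neg a)) = {{#a#}}"
| "dnf (Conj a b) = {{#a, b#}}"
| "dnf (Disj a b) = {{#a#}, {#b#}}"
| "dnf (Neg (Disj a b)) = {{#Neg a, Neg b#}}"
| "dnf (Neg (Conj a b)) = {{#Neg a#}, {#Neg b#}}"
| "dnf (Neg (Imp a b)) = {{#a, Neg b#}}"
| "dnf _ = {}"

fun literal :: "'p fm \<Rightarrow> bool" where
  "literal (Atom p) = True"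
| "literal (Neg (Atom p)) = True"
| "literal _ = False"

inductive gen :: "calculus \<Rightarrow> 'p fm multiset \<Rightarrow> 'p fm \<Rightarrow> bool" for L where
  ax: "literal l \<Longrightarrow> gen L (add_mset l \<Gamma>) l"
\<comment> \<open>Without the guard an empty \<open>dnf f\<close> would leave no premises, and an
  atom on the left would prove everything.\<close>
| left: "dnf f \<noteq> {} \<Longrightarrow> (\<And>M. M \<in> dnf f \<Longrightarrow> gen L (M + \<Gamma>) c) \<Longrightarrow> gen L (add_mset f \<Gamma>) c"
| right: "M \<in> dnf f \<Longrightarrow> (\<And>a. a \<in># M \<Longrightarrow> gen L \<Gamma> a) \<Longrightarrow> gen L \<Gamma> f"
| imp_l: "gen L (add_mset (Imp a b) \<Gamma>) a \<Longrightarrow> gen L (add_mset b \<Gamma>) c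
    \<Longrightarrow> gen L (add_mset (Imp a b) \<Gamma>) c"
| imp_r: "gen L (add_mset a \<Gamma>) b \<Longrightarrow> gen L \<Gamma> (Imp a b)"
| nec: "k \<in> necessities L \<Longrightarrow> gen L (proj (kept L k) \<Gamma>) (core k c) \<Longrightarrow> gen L \<Gamma> (mf k c)"
| poss: "(j, k) \<in> links L \<Longrightarrow> gen L (add_mset (core j a) (proj (kept L k) \<Gamma>)) (core k c)
    \<Longrightarrow> gen L (add_mset (mf j a) \<Gamma>) (mf k c)"

lemma proj_add [simp]: "proj K (add_mset a \<Gamma>) = part K a + proj K \<Gamma>"
  by (simp add: proj_def part_def boxes_def negdias_def)

lemma proj_plus [simp]: "proj K (\<Gamma> + \<Delta>) = proj K \<Gamma> + proj K \<Delta>"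
  by (simp add: proj_def boxes_def negdias_def)

lemma proj_subset: "K \<subseteq> K' \<Longrightarrow> set_mset (proj K \<Gamma>) \<subseteq> set_mset (proj K' \<Gamma>)"
  by (auto simp: proj_def)

lemma part_mf: "part K (mf k c) = (if k \<in> K \<inter> {KBox, KNegDia} then {#core k c#} else {#})"
  by (cases k) (auto simp: part_def)

lemma part_size: "a \<in># part K f \<Longrightarrow> size a < size f"
  by (cases f rule: negdiapart.cases) (auto simp: part_def split: if_splits)

lemma dnf_size: "M \<in> dnf f \<Longrightarrow> a \<in># M \<Longrightarrow> size a < size f"
  by (cases f rule: dnf.cases) auto

lemma core_size: "size (core k c) < size (mf k c)"
  by (cases k) auto

lemma part_dnf: "dnf f \<noteq> {} \<Longrightarrow> part K f = {#}"
  by (cases f rule: dnf.cases) (auto simp: part_def)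

lemma part_Imp [simp]: "part K (Imp a b) = {#}"
  by (simp add: part_def)

lemma dnf_mf [simp]: "dnf (mf k c) = {}"
  by (cases k) auto

lemma mf_inject [simp]: "mf j a = mf k b \<longleftrightarrow> j = k \<and> a = b"
  by (cases j; cases k) auto

lemma mf_neq_Imp [simp]: "mf k c \<noteq> Imp a b" "Imp a b \<noteq> mf k c"
  by (cases k; simp)+

lemma literal_dnf: "literal f \<Longrightarrow> dnf f = {}"
  by (cases f rule: literal.cases) auto

section \<open>Conditions on \<open>links\<close> and \<open>kept\<close> that hold in all six
  calculi\<close>

lemma links_range: "(j, k) \<in> links L \<Longrightarrow> {j, k} \<inter> {KBox, KNegDia} = {}"
  by (cases L) auto

text \<open>For a cut on a possibility of kind \<open>j\<close>: what supports it on the left must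
  also support the succedent of the right premise.\<close>

lemma links_trans: "(i, j) \<in> links L \<Longrightarrow> (j, k) \<in> links L \<Longrightarrow> (i, k) \<in> links L"
  by (cases L) auto

text \<open>In a cut between two \<open>poss\<close> steps both contexts must be projected alike in
  order to be merged.\<close>

lemma links_kept: "(j, k) \<in> links L \<Longrightarrow> kept L j = kept L k"
  by (cases L) auto

text \<open>When a kept necessity of kind \<open>j\<close> is cut, whatever its own derivation kept
  has to survive as well.\<close>

lemma kept_trans: "j \<in> kept L k \<Longrightarrow> kept L j \<subseteq> kept L k"
  by (cases L; cases j; cases k) auto

lemma part_link: "(j, k) \<in> links L \<Longrightarrow> part K (mf j a) = {#}" "(j, k) \<in> links L \<Longrightarrow> part K (mf k a) = {#}"
  using links_range[of j k L] by (auto simp: part_mf)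


section \<open>Structural rules\<close>

text \<open>Under a modal rule the induction hypothesis is used with the projection of the added
  formulas, so \<Delta> has to stay general.\<close>

lemma gen_weaken: "gen L \<Gamma> c \<Longrightarrow> gen L (\<Gamma> + \<Delta>) c"
proof (induction arbitrary: \<Delta> rule: gen.induct)
  case (left f \<Gamma> c)
  then show ?case by (metis gen.left add.assoc union_mset_add_mset_left)
qed (auto intro: gen.intros simp: add.assoc)

lemma gen_weaken': "gen L \<Gamma> c \<Longrightarrow> gen L (\<Delta> + \<Gamma>) c"
  using gen_weaken by (metis add.commute)

text \<open>If \<open>f\<close> is principal, the wanted sequent is a premise; otherwise the
  inversion moves to the premises. An implication is inverted only into the second premise of
  \<open>imp_l\<close>.\<close>

lemma gen_invert:
  assumes "gen L (add_mset f \<Gamma>) c" and "M \<in> dnf f \<or> (\<exists>a b. f = Imp a b \<and> M = {#b#})"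
  shows "gen L (M + \<Gamma>) c"
  using assms(1)
proof (induction "add_mset f \<Gamma>" c arbitrary: \<Gamma> rule: gen.induct)
  case (ax l \<Gamma>')
  then have "l \<noteq> f" using assms(2) literal_dnf by auto
  with ax obtain K where "\<Gamma> = add_mset l K" by (auto simp: add_eq_conv_ex)
  then show ?case using ax by (auto intro: gen.ax)
next
  case (left g \<Gamma>' c)
  show ?case
  proof (cases "g = f")
    case True
    then show ?thesis using left assms(2) by auto
  next
    case False
    with left(4) obtain K where K: "\<Gamma> = add_mset g K" "\<Gamma>' = add_mset f K"
      by (auto simp: add_eq_conv_ex)
    have "gen L (N + (M + K)) c" if "N \<in> dnf g" for N
      using left(3)[OF that, of "N + K"] K by (simp add: ac_simps)
    then show ?thesis using gen.left[OF left(1), of L "M + K" c] K by simp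
  qed
next
  case (right N g)
  show ?case using right(1) by (rule gen.right) (use right(3) in blast)
next
  case (imp_l a b \<Gamma>' c)
  show ?case
  proof (cases "f = Imp a b")
    case True
    then show ?thesis using imp_l assms(2) by auto
  next
    case False
    with imp_l(5) obtain K where K: "\<Gamma> = add_mset (Imp a b) K" "\<Gamma>' = add_mset f K"
      by (auto simp: add_eq_conv_ex)
    then show ?thesis
      using imp_l(2)[of "add_mset (Imp a b) K"] imp_l(4)[of "add_mset b K"] gen.imp_l[of L a b "M + K" c]
      by (auto simp: add_mset_commute)
  qed
next
  case (imp_r a b)
  show ?case using imp_r(2)[of "add_mset a \<Gamma>"] gen.imp_r[of L a "M + \<Gamma>" b]
    by (simp add: add_mset_commute)
next
  case (nec k c)
  \<comment> \<open>Neither a \<open>dnf\<close> formula nor an implication survives projection, so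
    the premise does not contain \<open>f\<close>, and the projection of \<open>M\<close> comes by
    weakening.\<close>
  have "part K f = {#}" for K using assms(2) part_dnf by auto
  then have "gen L (proj (kept L k) (M + \<Gamma>)) (core k c)"
    using nec(2) gen_weaken' by auto
  then show ?case using nec(1) gen.nec by blast
next
  case (poss j k a \<Gamma>' c)
  have p: "part K f = {#}" for K using assms(2) part_dnf by auto
  have "f \<noteq> mf j a" using assms(2) by auto
  with poss(4) obtain K where K: "\<Gamma> = add_mset (mf j a) K" "\<Gamma>' = add_mset f K"
    by (auto simp: add_eq_conv_ex)
  then have "gen L (add_mset (core j a) (proj (kept L k) (M + K))) (core k c)"
    using poss(2) p gen_weaken'[of L "add_mset (core j a) (proj (kept L k) K)" _ "proj (kept L k) M"]
    by simp
  then show ?case using gen.poss[OF poss(1), of a "M + K" c] K by simp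
qed

text \<open>Separates left rules acting on one of the two copies to be contracted from those acting
  elsewhere.\<close>

lemma dup_cases:
  assumes "add_mset g \<Delta> = add_mset f (add_mset f \<Gamma>)"
  obtains "g = f" "\<Delta> = add_mset f \<Gamma>"
  | K where "g \<noteq> f" "\<Gamma> = add_mset g K" "\<Delta> = add_mset f (add_mset f K)"
proof (cases "g = f")
  case True
  then show ?thesis using assms that(1) by simp
next
  case False
  with assms obtain K where "\<Delta> = add_mset f K" "add_mset f \<Gamma> = add_mset g K"
    by (auto simp: add_eq_conv_ex)
  with False show ?thesis using that(2) by (auto simp: add_eq_conv_ex)
qed

lemma contract_many:
  assumes "\<And>a \<Gamma> c. a \<in># M \<Longrightarrow> gen L (add_mset a (add_mset a \<Gamma>)) c \<Longrightarrow> gen L (add_mset a \<Gamma>) c"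
    and "gen L (M + (M + \<Gamma>)) c"
  shows "gen L (M + \<Gamma>) c"
  using assms
proof (induction M arbitrary: \<Gamma>)
  case (add a M)
  have "gen L (add_mset a (add_mset a (M + (M + \<Gamma>)))) c" using add.prems(2) by simp
  then have "gen L (M + (M + add_mset a \<Gamma>)) c" using add.prems(1)[of a "M + (M + \<Gamma>)"] by simp
  then have "gen L (M + add_mset a \<Gamma>) c" by (rule add.IH[rotated]) (use add.prems(1) in auto)
  then show ?case by simp
qed simp

lemma gen_contract:
  fixes f :: "'p fm"
  shows "gen L (add_mset f (add_mset f \<Gamma>)) c \<Longrightarrow> gen L (add_mset f \<Gamma>) c"
proof (induction "size f" arbitrary: f \<Gamma> c rule: less_induct)
  case less
  note smaller = less(1)
  have many: "gen L (M + \<Gamma>) c"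
    if "\<And>a. a \<in># M \<Longrightarrow> size a < size f" "gen L (M + (M + \<Gamma>)) c"
    for M \<Gamma> :: "'p fm multiset" and c
    by (rule contract_many[OF _ that(2)], rule smaller[OF that(1)])
  show ?case using less(2)
  proof (induction "add_mset f (add_mset f \<Gamma>)" c arbitrary: \<Gamma> rule: gen.induct)
    case (ax l \<Gamma>')
    then have "l \<in># add_mset f \<Gamma>" by (metis insert_iff set_mset_add_mset_insert)
    then show ?case using ax(1) gen.ax by (metis multi_member_split)
  next
    case (left g \<Gamma>' c)
    from left(4) show ?case
    proof (cases rule: dup_cases)
      case 1
      \<comment> \<open>One copy of \<open>f\<close> was decomposed into \<open>M\<close> by the
        rule; inverting the other doubles \<open>M\<close>, whose members are smaller than
        \<open>f\<close>.\<close>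
      have "gen L (M + \<Gamma>) c" if "M \<in> dnf f" for M
      proof (rule many)
        show "gen L (M + (M + \<Gamma>)) c"
          using left(2)[of M] 1 that gen_invert[of L f "M + \<Gamma>" c M] by (auto simp: ac_simps)
      qed (use that dnf_size in blast)
      then show ?thesis using gen.left left(1) 1 by blast
    next
      case (2 K)
      have "gen L (M + add_mset f K) c" if "M \<in> dnf g" for M
        using left(3)[OF that, of "M + K"] 2 by simp
      then show ?thesis using gen.left[OF left(1), of L "add_mset f K" c] 2
        by (simp add: add_mset_commute)
    qed
  next
    case (right M g)
    show ?case using right(1) by (rule gen.right) (use right(3) in blast)
  next
    case (imp_l a b \<Gamma>' c)
    from imp_l(5) show ?case
    proof (cases rule: dup_cases)
      case 1
      \<comment> \<open>The remaining copy of \<open>f\<close> is inverted to a second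
        \<open>b\<close>. The first premise still has \<open>f\<close> twice and is left to the
        inner induction.\<close>
      have "gen L ({#b#} + ({#b#} + \<Gamma>)) c"
        using imp_l(3) gen_invert[of L f "add_mset b \<Gamma>" c "{#b#}"] 1
        by (auto simp: add_mset_commute)
      then have "gen L ({#b#} + \<Gamma>) c" by (rule many[rotated]) (use 1 in auto)
      then show ?thesis using gen.imp_l[of L a b \<Gamma> c] imp_l(2)[of \<Gamma>] 1 by simp
    next
      case (2 K)
      then show ?thesis
        using imp_l(2)[of "add_mset (Imp a b) K"] imp_l(4)[of "add_mset b K"]
          gen.imp_l[of L a b "add_mset f K" c]
        by (auto simp: add_mset_commute)
    qed
  next
    case (imp_r a b)
    show ?case using imp_r(2)[of "add_mset a \<Gamma>"] gen.imp_r[of L a "add_mset f \<Gamma>" b]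
      by (simp add: add_mset_commute)
  next
    case (nec k c)
    \<comment> \<open>The two copies of \<open>f\<close> project to two copies of its part, whose
      members are smaller.\<close>
    have "gen L (part (kept L k) f + proj (kept L k) \<Gamma>) (core k c)"
      by (rule many) (use nec(2) part_size in auto)
    then show ?case using gen.nec[OF nec(1), of "add_mset f \<Gamma>"] by simp
  next
    case (poss j k a \<Gamma>' c)
    from poss(4) show ?case
    proof (cases rule: dup_cases)
      case 1
      \<comment> \<open>The spare copy is a possibility and vanished in the projection, so the same
        premise serves for the context \<Gamma>.\<close>
      have "part K f = {#}" for K using 1 part_link(1)[OF poss(1), of K a] by simp
      then show ?thesis using 1 poss(2) gen.poss[OF poss(1), of a \<Gamma>] by simp
    next
      case (2 K)
      let ?P = "part (kept L k) f"
      have "gen L (?P + (?P + add_mset (core j a) (proj (kept L k) K))) (core k c)"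
        using poss(2) 2 by simp
      then have "gen L (?P + add_mset (core j a) (proj (kept L k) K)) (core k c)"
        by (rule many[rotated]) (rule part_size)
      then show ?thesis
        using gen.poss[OF poss(1), of a "add_mset f K" c] 2 by (simp add: add_mset_commute)
    qed
  qed
qed

text \<open>After weakening, each member of \<Gamma> is contracted into its copy in \<Delta>. This
  absorbs the repeated contexts that cuts leave behind.\<close>

lemma gen_mono:
  assumes "gen L \<Gamma> c" "set_mset \<Gamma> \<subseteq> set_mset \<Delta>"
  shows "gen L \<Delta> c"
proof -
  have "gen L (\<Gamma> + \<Delta>) c" using assms(1) by (rule gen_weaken)
  then show ?thesis using assms(2)
  proof (induction \<Gamma>)
    case (add a \<Gamma>)
    then obtain D where "\<Delta> = add_mset a D" by (auto dest: multi_member_split)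
    then show ?case using add gen_contract[of L a "\<Gamma> + D"] by simp
  qed simp
qed


section \<open>Cut elimination\<close>

text \<open>The members of \<open>M\<close> are cut one after another; each cut adds a copy of
  \<Gamma>, merged by \<open>gen_mono\<close>.\<close>

lemma cut_many:
  assumes "\<And>a \<Delta>. a \<in># M \<Longrightarrow> gen L (add_mset a \<Delta>) c \<Longrightarrow> gen L (\<Gamma> + \<Delta>) c"
    and "gen L (M + \<Delta>) c"
  shows "gen L (\<Gamma> + \<Delta>) c"
  using assms
proof (induction M arbitrary: \<Delta>)
  case empty
  then show ?case using gen_weaken' by auto
next
  case (add a M)
  have "gen L (M + (\<Gamma> + \<Delta>)) c"
    using add.prems(1)[of a "M + \<Delta>"] add.prems(2) by (simp add: ac_simps)
  then have "gen L (\<Gamma> + (\<Gamma> + \<Delta>)) c" by (rule add.IH[rotated]) (use add.prems(1) in auto)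
  then show ?case by (rule gen_mono) auto
qed

text \<open>The induction on the right premise shared by all cut formulas without a
  \<open>dnf\<close>. The hypotheses \<open>imp\<close> and \<open>poss\<close> treat
  \<open>f\<close> as principal, \<open>part\<close> treats it as a formula projected by a modal
  rule; elsewhere the cut moves upwards.\<close>

lemma cut_right_induct:
  assumes dnf: "dnf f = {}" and left: "gen L \<Gamma> f"
    and imp: "\<And>a b \<Delta> c. f = Imp a b \<Longrightarrow> gen L (\<Gamma> + \<Delta>) a \<Longrightarrow> gen L (add_mset b \<Delta>) c
      \<Longrightarrow> gen L (\<Gamma> + \<Delta>) c"
    and part: "\<And>k N c. gen L (part (kept L k) f + N) c \<Longrightarrow> gen L (proj (kept L k) \<Gamma> + N) c"
    and poss: "\<And>j k a \<Delta> c. f = mf j a \<Longrightarrow> (j, k) \<in> links L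
      \<Longrightarrow> gen L (add_mset (core j a) (proj (kept L k) \<Delta>)) (core k c) \<Longrightarrow> gen L (\<Gamma> + \<Delta>) (mf k c)"
    and right: "gen L (add_mset f \<Delta>) c"
  shows "gen L (\<Gamma> + \<Delta>) c"
  using right
proof (induction "add_mset f \<Delta>" c arbitrary: \<Delta> rule: gen.induct)
  case (ax l \<Delta>')
  show ?case
  proof (cases "l = f")
    case True
    then show ?thesis using left gen_weaken by auto
  next
    case False
    then obtain K where "\<Delta> = add_mset l K" using ax(2) by (auto simp: add_eq_conv_ex)
    then show ?thesis using ax(1) gen.ax by auto
  qed
next
  case (left g \<Delta>' c)
  then have "g \<noteq> f" using dnf by auto
  with left(4) obtain K where K: "\<Delta> = add_mset g K" "\<Delta>' = add_mset f K"
    by (auto simp: add_eq_conv_ex)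
  have "gen L (M + (\<Gamma> + K)) c" if "M \<in> dnf g" for M
    using left(3)[OF that, of "M + K"] K by (simp add: ac_simps)
  then show ?case using gen.left[OF left(1), of L "\<Gamma> + K" c] K by simp
next
  case (right M g)
  show ?case using right(1) by (rule gen.right) (use right(3) in blast)
next
  case (imp_l a b \<Delta>' c)
  show ?case
  proof (cases "f = Imp a b")
    case True
    then show ?thesis using imp_l imp by auto
  next
    case False
    with imp_l(5) obtain K where K: "\<Delta> = add_mset (Imp a b) K" "\<Delta>' = add_mset f K"
      by (auto simp: add_eq_conv_ex)
    then show ?thesis
      using imp_l(2)[of "add_mset (Imp a b) K"] imp_l(4)[of "add_mset b K"]
        gen.imp_l[of L a b "\<Gamma> + K" c]
      by (auto simp: add_mset_commute)
  qed
next
  case (imp_r a b)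
  show ?case using imp_r(2)[of "add_mset a \<Delta>"] gen.imp_r[of L a "\<Gamma> + \<Delta>" b]
    by (simp add: add_mset_commute)
next
  case (nec k c)
  then show ?case using part gen.nec[OF nec(1), of "\<Gamma> + \<Delta>" c] by simp
next
  case (poss j k a \<Delta>' c)
  show ?case
  proof (cases "f = mf j a")
    case True
    then show ?thesis using poss assms(5)[of j a k \<Delta> c] by auto
  next
    case False
    with poss(4) obtain K where K: "\<Delta> = add_mset (mf j a) K" "\<Delta>' = add_mset f K"
      by (auto simp: add_eq_conv_ex)
    then have "gen L (proj (kept L k) \<Gamma> + add_mset (core j a) (proj (kept L k) K)) (core k c)"
      using part[of k "add_mset (core j a) (proj (kept L k) K)"] poss(2) by simp
    then show ?thesis using gen.poss[OF poss(1), of a "\<Gamma> + K" c] K by simp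
  qed
qed

lemma gen_cut: "gen L \<Gamma> f \<Longrightarrow> gen L (add_mset f \<Delta>) c \<Longrightarrow> gen L (\<Gamma> + \<Delta>) c"
proof (induction "size f" arbitrary: f \<Gamma> \<Delta> c rule: less_induct)
  case less
  note cut = less(1)
  \<comment> \<open>The induction turns the cut formula into the succedent of each rule, so the
    hypothesis \<open>cut\<close> about smaller formulas is passed through it.\<close>
  show ?case using less(2) cut less(3)
  proof (induction arbitrary: \<Delta> c rule: gen.induct)
    case (ax l \<Gamma>)
    then show ?case using gen_weaken[of L "add_mset l \<Delta>" c \<Gamma>] by (simp add: ac_simps)
  next
    case (left g \<Gamma> f)
    have "gen L (M + (\<Gamma> + \<Delta>)) c" if "M \<in> dnf g" for M
      using left(3)[OF that left(4,5)] by (simp add: ac_simps)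
    then show ?case using gen.left[OF left(1), of L "\<Gamma> + \<Delta>" c] by simp
  next
    case (right M f \<Gamma>)
    show ?case
    \<comment> \<open>Inversion replaces \<open>f\<close> in the right premise by the disjunct
      \<open>M\<close> that was proved on the left; the cuts are then on its smaller
      members.\<close>
    proof (rule cut_many)
      show "gen L (M + \<Delta>) c" using gen_invert right(1,5) by blast
      show "gen L (\<Gamma> + \<Delta>) c" if "a \<in># M" "gen L (add_mset a \<Delta>) c" for a \<Delta>
        using right(4)[OF _ right(2)] that dnf_size[OF right(1)] by blast
    qed
  next
    case (imp_l a b \<Gamma> f)
    \<comment> \<open>Only the second premise proves the cut formula; the first needs just
      weakening.\<close>
    have "gen L (add_mset b (\<Gamma> + \<Delta>)) c" using imp_l(4)[OF imp_l(5,6)] by simp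
    then show ?case
      using gen.imp_l[of L a b "\<Gamma> + \<Delta>" c] gen_weaken[OF imp_l(1), of \<Delta>] by simp
  next
    case (imp_r a \<Gamma> b)
    show ?case
    proof (rule cut_right_induct[OF _ _ _ _ _ imp_r(4)])
      show "gen L \<Gamma> (Imp a b)" using imp_r(1) by (rule gen.imp_r)
    next
      fix a' b' \<Delta> c
      assume f: "Imp a b = Imp a' b'" and a: "gen L (\<Gamma> + \<Delta>) a'" and b: "gen L (add_mset b' \<Delta>) c"
      \<comment> \<open>The cut on the implication becomes a cut on its antecedent followed by one
        on its consequent.\<close>
      have "gen L (\<Gamma> + \<Delta> + \<Gamma>) b" by (rule imp_r(3)[OF _ _ imp_r(1)]) (use f a in auto)
      then have "gen L (\<Gamma> + \<Delta> + \<Gamma> + \<Delta>) c" by (rule imp_r(3)[rotated]) (use f b in auto)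
      then show "gen L (\<Gamma> + \<Delta>) c" by (rule gen_mono) auto
    qed (auto intro: gen_weaken')
  next
    case (nec j \<Gamma> d)
    show ?case
    proof (rule cut_right_induct[OF _ _ _ _ _ nec(5)])
      show "gen L \<Gamma> (mf j d)" using nec(1,2) by (rule gen.nec)
    next
      fix k N c
      assume N: "gen L (part (kept L k) (mf j d) + N) c"
      show "gen L (proj (kept L k) \<Gamma> + N) c"
      proof (cases "part (kept L k) (mf j d) = {#}")
        case True
        then show ?thesis using N gen_weaken' by auto
      next
        case False
        then have p: "part (kept L k) (mf j d) = {#core j d#}" and j: "j \<in> kept L k"
          by (auto simp: part_mf split: if_splits)
        \<comment> \<open>The kept necessity occurs in the right premise as its core, where the
          smaller cut is made; \<open>kept_trans\<close> then enlarges the projection.\<close>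
        have "gen L (proj (kept L j) \<Gamma> + N) c"
          by (rule nec(4)[OF core_size nec(2)]) (use N p in auto)
        then show ?thesis
          by (rule gen_mono) (use proj_subset[OF kept_trans[OF j], of \<Gamma>] in auto)
      qed
    next
      \<comment> \<open>A link never starts at a necessity, so this case is contradictory.\<close>
      fix i k a \<Delta> c
      assume "mf j d = mf i a" "(i, k) \<in> links L"
      then show "gen L (\<Gamma> + \<Delta>) (mf k c)"
        using nec(1) links_range[of i k L] by (auto simp: necessities_def split: if_splits)
    qed auto
  next
    case (poss i j a \<Gamma> d)
    show ?case
    proof (rule cut_right_induct[OF _ _ _ _ _ poss(5)])
      show "gen L (add_mset (mf i a) \<Gamma>) (mf j d)" using poss(1,2) by (rule gen.poss)
    next
      fix k N c
      assume "gen L (part (kept L k) (mf j d) + N) c"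
      then show "gen L (proj (kept L k) (add_mset (mf i a) \<Gamma>) + N) c"
        using gen_weaken' part_link(2)[OF poss(1), of "kept L k" d] by auto
    next
      fix j' k a' \<Delta> c
      assume eq: "mf j d = mf j' a'" and link: "(j', k) \<in> links L"
        and prem: "gen L (add_mset (core j' a') (proj (kept L k) \<Delta>)) (core k c)"
      \<comment> \<open>The cut is made on the core between the two modal premises;
        \<open>links_kept\<close> joins the projections and \<open>links_trans\<close> allows the
        rule to be applied again.\<close>
      have "gen L (add_mset (core i a) (proj (kept L j) \<Gamma>) + proj (kept L k) \<Delta>) (core k c)"
        by (rule poss(4)[OF core_size poss(2)]) (use prem eq in auto)
      then have "gen L (add_mset (core i a) (proj (kept L k) (\<Gamma> + \<Delta>))) (core k c)"
        using links_kept[OF link] eq by simp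
      then show "gen L (add_mset (mf i a) \<Gamma> + \<Delta>) (mf k c)"
        using gen.poss[OF links_trans[OF poss(1)], of k a "\<Gamma> + \<Delta>" c] link eq by simp
    qed auto
  qed
qed


section \<open>Equivalence with the given calculi\<close>

text \<open>Each modal rule is \<open>gen.nec\<close> or \<open>gen.poss\<close> at fixed kinds;
  splitting on \<open>L\<close> discards the calculi lacking the rule and evaluates
  \<open>kept\<close>.\<close>

lemma provable_imp_gen: "provable L \<Gamma> c \<Longrightarrow> gen L \<Gamma> c"
proof (induction rule: provable.induct)
  case (disj_l a \<Gamma> c b)
  show ?case by (rule gen.left) (use disj_l in auto)
next
  case (negconj_l a \<Gamma> c b)
  show ?case by (rule gen.left) (use negconj_l in auto)
next
  case (imp_l a b \<Gamma> c)
  then show ?case by (blast intro: gen.imp_l)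
next
  case (box \<Gamma> c)
  then show ?case using gen.nec[of KBox L \<Gamma> c]
    by (cases L) (auto simp: necessities_def proj_def)
next
  case (dia a c \<Gamma>)
  then show ?case using gen.poss[of KDia KDia L a \<Gamma> c]
    by (cases L) (auto simp: proj_def)
next
  case (box_neg a c \<Gamma>)
  then show ?case using gen.poss[of KNegBox KNegBox L a \<Gamma> c]
    by (cases L) (auto simp: proj_def)
next
  case (dia_neg \<Gamma> c)
  then show ?case using gen.nec[of KNegDia L \<Gamma> c]
    by (cases L) (auto simp: necessities_def proj_def)
next
  case (dia_pm a \<Gamma> c)
  then show ?case using gen.poss[of KDia KDia L a \<Gamma> c]
    by (cases L) (auto simp: proj_def)
next
  case (box_neg_pm a \<Gamma> c)
  then show ?case using gen.poss[of KNegBox KNegBox L a \<Gamma> c]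
    by (cases L) (auto simp: proj_def)
next
  case (dia_vee a \<Gamma> c)
  then show ?case using gen.poss[of KDia KDia L a \<Gamma> c]
    by (cases L) (auto simp: proj_def)
next
  case (box_neg_vee a \<Gamma> c)
  then show ?case using gen.poss[of KNegBox KNegBox L a \<Gamma> c]
    by (cases L) (auto simp: proj_def)
next
  case (box_join \<Gamma> c)
  then show ?case using gen.nec[of KBox L \<Gamma> c]
    by (cases L) (auto simp: necessities_def proj_def)
next
  case (dia_join a c \<Gamma>)
  then show ?case using gen.poss[of KNegBox KDia L a \<Gamma> c]
    by (cases L) (auto simp: proj_def)
next
  case (box_neg_join a c \<Gamma>)
  then show ?case using gen.poss[of KDia KNegBox L a \<Gamma> c]
    by (cases L) (auto simp: proj_def)
next
  case (dia_neg_join \<Gamma> c)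
  then show ?case using gen.nec[of KNegDia L \<Gamma> c]
    by (cases L) (auto simp: necessities_def proj_def)
next
  case (dia_1 a \<Gamma> c)
  then show ?case using gen.poss[of KDia KDia L a \<Gamma> c]
    by (cases L) (auto simp: proj_def)
next
  case (box_neg_1 a \<Gamma> c)
  then show ?case using gen.poss[of KNegBox KNegBox L a \<Gamma> c]
    by (cases L) (auto simp: proj_def)
next
  case (dia_1join a \<Gamma> c)
  then show ?case using gen.poss[of KNegBox KDia L a \<Gamma> c]
    by (cases L) (auto simp: proj_def)
next
  case (box_neg_1join a \<Gamma> c)
  then show ?case using gen.poss[of KDia KNegBox L a \<Gamma> c]
    by (cases L) (auto simp: proj_def)
qed (auto intro: gen.ax gen.imp_r gen.left gen.right)

text \<open>The parameters admit nothing new: each combination of calculus and kinds allowed by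
  \<open>necessities\<close> or \<open>links\<close> is one of the given rules.\<close>

lemma gen_imp_provable: "gen L \<Gamma> c \<Longrightarrow> provable L \<Gamma> c"
proof (induction rule: gen.induct)
  case (ax l \<Gamma>)
  then show ?case by (cases l rule: literal.cases) (auto intro: provable.intros)
next
  case (left f \<Gamma> c)
  \<comment> \<open>A bounded quantifier over \<open>dnf f\<close> unfolds into the separate
    premises once the shape of \<open>f\<close> is known.\<close>
  have "\<forall>M\<in>dnf f. provable L (M + \<Gamma>) c" using left(3) by blast
  with left(1) show ?case by (cases f rule: dnf.cases) (auto intro: provable.negneg_l
      provable.conj_l provable.disj_l provable.negdisj_l provable.negconj_l provable.negimp_l)
next
  case (right M f \<Gamma>)
  from right(1,3) show ?case by (cases f rule: dnf.cases) (auto intro: provable.negneg_r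
      provable.conj_r provable.disj_r1 provable.disj_r2 provable.negdisj_r provable.negconj_r1
      provable.negconj_r2 provable.negimp_r)
next
  case (nec k \<Gamma> c)
  from nec(1,3) show ?case
    by (cases L; cases k)
      (simp_all add: necessities_def proj_def provable.box provable.dia_neg
        provable.box_join provable.dia_neg_join)
next
  case (poss j k a \<Gamma> c)
  from poss(1,3) show ?case
    by (cases L; cases j; cases k)
      (simp_all add: proj_def provable.dia provable.box_neg provable.dia_pm
        provable.box_neg_pm provable.dia_vee provable.box_neg_vee provable.dia_join
        provable.box_neg_join provable.dia_1 provable.box_neg_1 provable.dia_1join
        provable.box_neg_1join)
qed (blast intro: provable.imp_l provable.imp_r)+

theorem theorem5:
  fixes L :: calculus and \<Gamma> \<Delta> :: "('p::countable) fm multiset" and \<phi> \<chi> :: "'p fm"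
  assumes "\<forall>a\<in>#\<Gamma> + \<Delta>. in_language L a"
      and "in_language L \<phi>" and "in_language L \<chi>"
      and "provable L \<Gamma> \<phi>"
      and "provable L (add_mset \<phi> \<Delta>) \<chi>"
  shows "provable L (\<Gamma> + \<Delta>) \<chi>"
  using assms(4,5) gen_cut gen_imp_provable provable_imp_gen by blast

end
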